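(* Let $A$ be a $d\times n$ integer matrix with columns $a_1,\dots,a_n\in\mathbb{Z}^d$, and assume there is $l\in\mathbb{R}^d$ with $\langle l,a_i\rangle<0$ for all $i$. Let $G=\{A\xi:\ \xi\in\mathbb{Z}^n_{\ge 0}\}$ and $f(\mathbf{z})=\sum_{b\in G}\mathbf{z}^b$. Let $\Lambda=\{\lambda\in\mathbb{Z}^n:\ A\lambda=0\}$, let $S$ be the neighborhood complex on $\Lambda$ (defined below), and let $\bar S$ be a set of distinct representatives of $S$ modulo $\Lambda$. Define \[f_{\bar S}(\mathbf{z})=\frac{\sum_{s\in\bar S}(-1)^{\dim(s)}\mathbf{z}^{A\cdot\max(s)}}{\prod_{i=1}^n(1-\mathbf{z}^{a_i})}.\] Then $f(\mathbf{z})=f_{\bar S}(\mathbf{z})$.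
   Context: Notation: $\mathbf{z}=(z_1,\dots,z_d)$ and $\mathbf{z}^b=z_1^{b_1}\cdots z_d^{b_d}$. Both sides are understood as Laurent series in $\mathbf{z}$ obtained by expanding each $1/(1-\mathbf{z}^{a_i})$ as $\sum_{k\ge0}\mathbf{z}^{ka_i}$; equivalently as analytic functions on a neighborhood of $(e^{l_1},\dots,e^{l_d})$, where all these series converge. For vectors in $\mathbb{R}^n$, $x\le y$ means $x_i\le y_i$ for all $i$, and $x<y$ means $x_i<y_i$ for all $i$. For a finite set $s=\{\lambda^1,\dots,\lambda^k\}\subset\mathbb{R}^n$, $\max(s)$ is the coordinatewise maximum. A simplicial complex on a vertex set $V$ is a collection of nonempty finite subsets of $V$ closed under taking nonempty subsets; $\dim(s)=|s|-1$. The lattice $\Lambda$ is called generic if whenever a nonzero $\lambda\in\Lambda$ has $\lambda_i=0$ for some $i$, there is $\lambda'\in\Lambda$ with $\lambda'<\max(\lambda,0)$. A proper perturbation is a map $\varphi:\Lambda\to\mathbb{R}^n$ such that for all $x,y\in\Lambda$ and all $i$: (1) if $x\ne y$ then $[\varphi(x)]_i\neq[\varphi(y)]_i$; (2) if $[\varphi(x)]_i<[\varphi(y)]_i$ then $x_i\le y_i$; (3) if $[\varphi(x)]_i<[\varphi(y)]_i$ then $[\varphi(x+\lambda)]_i<[\varphi(y+\lambda)]_i$ for all $\lambda\in\Lambda$. Neighborhood complex $S$: if $\Lambda$ is generic, a nonempty finite $s\subset\Lambda$ belongs to $S$ iff there is no $\lambda\in\Lambda$ with $\lambda<\max(s)$;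 if $\Lambda$ is not generic, fix any proper perturbation $\varphi$, and $s$ belongs to $S$ iff there is no $\lambda\in\Lambda$ with $\varphi(\lambda)<\max(\varphi(s))$, where $\varphi(s)=\{\varphi(\lambda):\lambda\in s\}$ (the theorem holds for any such choice). $S$ is invariant under translation by $\Lambda$ ($s+\lambda=\{x+\lambda: x\in s\}$), and $\bar S$ contains exactly one simplex from each translation class. *)

theory Defs
  imports "HOL-Analysis.Analysis"
begin

definition lattice_of :: "int ^ 'n ^ 'd \<Rightarrow> (int ^ 'n) set" where
  "lattice_of A = {x. A *v x = 0}"

definition semigroup_of :: "int ^ 'n ^ 'd \<Rightarrow> (int ^ 'd) set" where
  "semigroup_of A = {A *v \<xi> | \<xi>. \<forall>i. 0 \<le> \<xi> $ i}"

text \<open>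
  Strict inequality in every coordinate.  This is not the library's order \<open><\<close> on vectors,
  for which \<open>x < y\<close> means \<open>x \<le> y\<close> and \<open>x \<noteq> y\<close>.
\<close>
definition strictly_below :: "'a::linorder ^ 'n \<Rightarrow> 'a ^ 'n \<Rightarrow> bool" where
  "strictly_below x y \<longleftrightarrow> (\<forall>i. x $ i < y $ i)"

definition coord_max :: "('a::linorder ^ 'n) set \<Rightarrow> 'a ^ 'n" where
  "coord_max s = (\<chi> i. Max ((\<lambda>x. x $ i) ` s))"

definition generic_lattice :: "(int ^ 'n) set \<Rightarrow> bool" where
  "generic_lattice L \<longleftrightarrow>
     (\<forall>x\<in>L. x \<noteq> 0 \<and> (\<exists>i. x $ i = 0) \<longrightarrow> (\<exists>y\<in>L. strictly_below y (coord_max {x, 0})))"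

text \<open>Only the values of \<open>\<phi>\<close> on \<open>L\<close> matter.\<close>
definition proper_perturbation :: "(int ^ 'n) set \<Rightarrow> (int ^ 'n \<Rightarrow> real ^ 'n) \<Rightarrow> bool" where
  "proper_perturbation L \<phi> \<longleftrightarrow>
     (\<forall>x\<in>L. \<forall>y\<in>L. \<forall>i.
        (x \<noteq> y \<longrightarrow> \<phi> x $ i \<noteq> \<phi> y $ i) \<and>
        (\<phi> x $ i < \<phi> y $ i \<longrightarrow> x $ i \<le> y $ i) \<and>
        (\<phi> x $ i < \<phi> y $ i \<longrightarrow> (\<forall>v\<in>L. \<phi> (x + v) $ i < \<phi> (y + v) $ i)))"

text \<open>The argument \<open>\<phi>\<close> is ignored when \<open>L\<close> is generic.\<close>
definition neighborhood_complex ::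
    "(int ^ 'n) set \<Rightarrow> (int ^ 'n \<Rightarrow> real ^ 'n) \<Rightarrow> (int ^ 'n) set set" where
  "neighborhood_complex L \<phi> =
     {s. finite s \<and> s \<noteq> {} \<and> s \<subseteq> L \<and>
         (if generic_lattice L
          then \<not> (\<exists>x\<in>L. strictly_below x (coord_max s))
          else \<not> (\<exists>x\<in>L. strictly_below (\<phi> x) (coord_max (\<phi> ` s))))}"

definition representatives_mod ::
    "(int ^ 'n) set \<Rightarrow> (int ^ 'n) set set \<Rightarrow> (int ^ 'n) set set \<Rightarrow> bool" where
  "representatives_mod L S T \<longleftrightarrow>
     T \<subseteq> S \<and> (\<forall>s\<in>S. \<exists>!t. t \<in> T \<and> (\<exists>v\<in>L. t = (\<lambda>x. x + v) ` s))"

definition simplex_dim :: "'a set \<Rightarrow> nat" where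
  "simplex_dim s = card s - 1"

definition monomial :: "complex ^ 'd \<Rightarrow> int ^ 'd \<Rightarrow> complex" where
  "monomial z b = (\<Prod>j\<in>UNIV. (z $ j) powi (b $ j))"

text \<open>
  The points at which all monomials are defined and all the geometric series
  \<open>\<Sum>k\<ge>0. monomial z (k a\<^sub>i)\<close> converge, so that the expansion of \<open>1 / (1 - monomial z a\<^sub>i)\<close>
  is valid.  It is open, and it contains \<open>(exp l\<^sub>1, \<dots>, exp l\<^sub>d)\<close> whenever
  \<open>l\<close> has negative inner product with every column of \<open>A\<close>; see the two lemmas below.
\<close>
definition convergence_domain :: "int ^ 'n ^ 'd \<Rightarrow> (complex ^ 'd) set" where
  "convergence_domain A =
     {z. (\<forall>j. z $ j \<noteq> 0) \<and> (\<forall>i. norm (monomial z (column i A)) < 1)}"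

definition semigroup_gf :: "int ^ 'n ^ 'd \<Rightarrow> complex ^ 'd \<Rightarrow> complex" where
  "semigroup_gf A z = (\<Sum>\<^sub>\<infinity>b\<in>semigroup_of A. monomial z b)"

text \<open>
  The sum over \<open>T\<close> is an unconditional (possibly infinite) sum: for a proper perturbation
  whose coordinate orders are lexicographic, there can be infinitely many simplices modulo the
  lattice, for example for \<open>{(x, -x, y, -y)}\<close>, with coordinates 1 and 2 ordered by
  \<open>(x, y)\<close> lexicographically and by its reverse.  On a finite \<open>T\<close> it is the ordinary sum.
\<close>
definition complex_gf :: "int ^ 'n ^ 'd \<Rightarrow> (int ^ 'n) set set \<Rightarrow> complex ^ 'd \<Rightarrow> complex" where
  "complex_gf A T z =
     (\<Sum>\<^sub>\<infinity>s\<in>T. (-1) ^ simplex_dim s * monomial z (A *v coord_max s)) /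
     (\<Prod>i\<in>UNIV. 1 - monomial z (column i A))"

lemma exp_in_convergence_domain:
  fixes A :: "int ^ 'n ^ 'd" and l :: "real ^ 'd"
  assumes "\<And>i. l \<bullet> (\<chi> j. real_of_int (column i A $ j)) < 0"
  shows "(\<chi> j. complex_of_real (exp (l $ j))) \<in> convergence_domain A"
proof -
  have "norm (monomial (\<chi> j. complex_of_real (exp (l $ j))) b)
      = exp (l \<bullet> (\<chi> j. real_of_int (b $ j)))" for b :: "int ^ 'd"
  proof -
    have "norm (monomial (\<chi> j. complex_of_real (exp (l $ j))) b)
        = (\<Prod>j\<in>UNIV. exp (l $ j) powi (b $ j))"
      by (simp add: monomial_def prod_norm[symmetric] norm_power_int)
    also have "\<dots> = (\<Prod>j\<in>UNIV. exp (l $ j * real_of_int (b $ j)))"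
      by (simp add: exp_power_int mult.commute)
    finally show ?thesis
      by (simp add: inner_vec_def exp_sum)
  qed
  with assms show ?thesis
    by (simp add: convergence_domain_def)
qed

lemma open_convergence_domain:
  fixes A :: "int ^ 'n ^ 'd"
  shows "open (convergence_domain A)"
proof -
  let ?U = "{z :: complex ^ 'd. \<forall>j. z $ j \<noteq> 0}"
  have "open (\<Inter>j::'d. {z :: complex ^ 'd. z $ j \<noteq> 0})"
    by (intro open_INT ballI open_Collect_neq continuous_intros) auto
  moreover have "(\<Inter>j::'d. {z :: complex ^ 'd. z $ j \<noteq> 0}) = ?U"
    by auto
  ultimately have U: "open ?U" by simp
  have "continuous_on ?U (\<lambda>z. norm (monomial z b))" for b :: "int ^ 'd"
    unfolding monomial_def by (intro continuous_intros) auto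
  then have "open (\<Inter>i::'n. ?U \<inter> (\<lambda>z. norm (monomial z (column i A))) -` {..<1})"
    by (intro open_INT ballI continuous_open_preimage U) auto
  moreover have "(\<Inter>i::'n. ?U \<inter> (\<lambda>z. norm (monomial z (column i A))) -` {..<1}) = convergence_domain A"
    by (auto simp: convergence_domain_def)
  ultimately show ?thesis by simp
qed

end

theory Submission imports Defs begin

text \<open>
  Multiplied out, the right-hand side is the sum of \<open>(-1)\<^bsup>dim s\<^esup> z\<^bsup>A (max s + \<xi>)\<^esup>\<close> over representatives
  \<open>s\<close> and \<open>\<xi> \<ge> 0\<close>.  If \<open>b = A u\<close> with \<open>u \<ge> 0\<close>, translating \<open>s\<close> by \<open>u - (max s + \<xi>)\<close> puts the terms with
  exponent \<open>b\<close> in bijection with the simplices of the whole complex whose maximum is \<open>\<le> u\<close>.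
  These form a finite complex of Euler characteristic 1: a nonempty set of lattice points \<open>\<le> u\<close> that
  is not a simplex has a lattice point strictly below its maximum, and adding or removing that point
  does not change the maximum, so the non-simplices cancel in pairs.
  Convergence holds even for infinitely many simplices because each vertex of a simplex attains
  the maximum in a coordinate of its own, so that a simplex has at most \<open>n\<close> vertices.
\<close>

section \<open>Cancellation of signs in pairs\<close>

definition toggle :: "'a \<Rightarrow> 'a set \<Rightarrow> 'a set" where
  "toggle v s = (if v \<in> s then s - {v} else insert v s)"

text \<open>The point to toggle may depend on \<open>s\<close>, but \<open>inv\<close> says that the
  choice survives the toggle, so toggling is an involution of \<open>X\<close>. It changes the
  cardinality by one, hence the sum equals its own negative.\<close>

lemma sum_sign_toggle_eq_0:
  fixes v :: "'a set \<Rightarrow> 'a"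
  assumes fin: "\<And>s. s \<in> X \<Longrightarrow> finite s"
    and closed: "\<And>s. s \<in> X \<Longrightarrow> toggle (v s) s \<in> X"
    and inv: "\<And>s. s \<in> X \<Longrightarrow> v (toggle (v s) s) = v s"
  shows "(\<Sum>s\<in>X. (-1) ^ card s) = (0 :: 'c :: {idom, ring_char_0})"
proof -
  have tt: "toggle w (toggle w s) = s" for w :: 'a and s
    by (auto simp: toggle_def)
  have card: "(-1 :: 'c) ^ card (toggle w s) = - ((-1) ^ card s)" if "finite s" for w :: 'a and s
    by (cases "card s") (use that in \<open>auto simp: toggle_def card_Diff_singleton\<close>)
  have "(\<Sum>s\<in>X. (-1 :: 'c) ^ card s) = (\<Sum>s\<in>X. (-1) ^ card (toggle (v s) s))"
    by (rule sum.reindex_bij_witness[of _ "\<lambda>s. toggle (v s) s" "\<lambda>s. toggle (v s) s"])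
      (use tt inv closed in auto)
  also have "\<dots> = - (\<Sum>s\<in>X. (-1) ^ card s)"
    using fin by (simp add: card sum_negf)
  finally have "2 * (\<Sum>s\<in>X. (-1 :: 'c) ^ card s) = 0"
    by (metis add.right_inverse mult_2)
  then show ?thesis by simp
qed

section \<open>Coordinatewise maxima\<close>

lemma coord_max_le_iff:
  fixes s :: "('a::linorder ^ 'n) set"
  assumes "finite s" "s \<noteq> {}"
  shows "coord_max s $ i \<le> k \<longleftrightarrow> (\<forall>x\<in>s. x $ i \<le> k)"
  using assms by (simp add: coord_max_def)

lemma coord_max_ge:
  fixes s :: "('a::linorder ^ 'n) set"
  assumes "finite s" "x \<in> s"
  shows "x $ i \<le> coord_max s $ i"
  using assms by (simp add: coord_max_def)

text \<open>Removes the maximum from the condition defining simplices; \<open>f\<close> is the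
  identity for a generic lattice and the perturbation otherwise.\<close>

lemma strictly_below_coord_max_iff:
  fixes f :: "'b \<Rightarrow> 'a::linorder ^ 'n"
  assumes "finite s" "s \<noteq> {}"
  shows "strictly_below x (coord_max (f ` s)) \<longleftrightarrow> (\<forall>i. \<exists>y\<in>s. x $ i < f y $ i)"
  using assms by (simp add: strictly_below_def coord_max_def Max_gr_iff)

lemma coord_max_translate:
  fixes s :: "(int ^ 'n) set"
  assumes "finite s" "s \<noteq> {}"
  shows "coord_max ((\<lambda>x. x + v) ` s) = coord_max s + v"
  using assms by (simp add: coord_max_def vec_eq_iff image_image Max_add_commute)

lemma simplex_dim_translate:
  fixes s :: "(int ^ 'n) set"
  shows "simplex_dim ((\<lambda>x. x + v) ` s) = simplex_dim s"
  by (simp add: simplex_dim_def card_image)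

section \<open>Summation over integer vectors and over finite sets\<close>

lemma bij_betw_vec_lambda:
  "bij_betw vec_lambda (PiE UNIV B) {v :: 'a ^ 'n. \<forall>i. v $ i \<in> B i}"
  by (rule bij_betw_byWitness[where f' = vec_nth]) auto

lemma finite_vec_box:
  assumes "\<And>i. finite (B i)"
  shows "finite {v :: 'a ^ 'n. \<forall>i. v $ i \<in> B i}"
  using bij_betw_finite[OF bij_betw_vec_lambda[of B]] assms by (simp add: finite_PiE)

text \<open>A finite set \<open>F\<close> of functions lies in the box of its projections
  \<open>C i\<close>. Over this finite box the sum of products factors, and each factor is at most
  the corresponding infinite sum.\<close>

lemma abs_summable_on_prod_PiE:
  fixes f :: "'a \<Rightarrow> 'b \<Rightarrow> 'c :: {banach, real_normed_field}"
  assumes "finite I" and f: "\<And>i. i \<in> I \<Longrightarrow> f i abs_summable_on B i"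
  shows "(\<lambda>g. \<Prod>i\<in>I. f i (g i)) abs_summable_on PiE I B"
proof (rule nonneg_bdd_above_summable_on)
  show "bdd_above (sum (\<lambda>g. norm (\<Prod>i\<in>I. f i (g i))) ` {F. F \<subseteq> PiE I B \<and> finite F})"
  proof (rule bdd_aboveI2)
    fix F assume "F \<in> {F. F \<subseteq> PiE I B \<and> finite F}"
    then have F: "F \<subseteq> PiE I B" "finite F" by auto
    define C where "C i = (\<lambda>g. g i) ` F" for i
    have C: "finite (C i)" "i \<in> I \<Longrightarrow> C i \<subseteq> B i" for i
      using F by (auto simp: C_def)
    have sub: "F \<subseteq> PiE I C"
      using F by (auto simp: C_def PiE_iff)
    have "(\<Sum>g\<in>F. norm (\<Prod>i\<in>I. f i (g i))) \<le> (\<Sum>g\<in>PiE I C. norm (\<Prod>i\<in>I. f i (g i)))"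
      using sub C assms by (intro sum_mono2 finite_PiE) auto
    also have "\<dots> = (\<Prod>i\<in>I. \<Sum>k\<in>C i. norm (f i k))"
      using C assms by (simp add: prod_norm[symmetric] prod_sum_PiE)
    also have "\<dots> \<le> (\<Prod>i\<in>I. \<Sum>\<^sub>\<infinity>k\<in>B i. norm (f i k))"
      using C f by (intro prod_mono conjI sum_nonneg finite_sum_le_infsum) auto
    finally show "(\<Sum>g\<in>F. norm (\<Prod>i\<in>I. f i (g i))) \<le> (\<Prod>i\<in>I. \<Sum>\<^sub>\<infinity>k\<in>B i. norm (f i k))" .
  qed
qed auto

lemma abs_summable_on_prod_vec:
  fixes f :: "'n::finite \<Rightarrow> 'b \<Rightarrow> 'c :: {banach, real_normed_field}"
  assumes "\<And>i. f i abs_summable_on B i"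
  shows "(\<lambda>v. \<Prod>i\<in>UNIV. f i (v $ i)) abs_summable_on {v. \<forall>i. v $ i \<in> B i}"
  using abs_summable_on_prod_PiE[of UNIV f B] assms
  by (subst summable_on_reindex_bij_betw[OF bij_betw_vec_lambda, symmetric]) simp

lemma infsum_prod_vec:
  fixes f :: "'n::finite \<Rightarrow> 'b \<Rightarrow> 'c :: {banach, real_normed_field}"
  assumes "\<And>i. f i abs_summable_on B i"
  shows "(\<Sum>\<^sub>\<infinity>v\<in>{v. \<forall>i. v $ i \<in> B i}. \<Prod>i\<in>UNIV. f i (v $ i)) = (\<Prod>i\<in>UNIV. infsum (f i) (B i))"
  using infsum_prod_PiE_abs[of UNIV f B] assms
  by (subst infsum_reindex_bij_betw[OF bij_betw_vec_lambda, symmetric]) simp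

text \<open>The geometric series carried along \<open>int\<close>, because monomials have integer
  exponents and the later sums run over integer vectors.\<close>

lemma has_sum_geometric_int:
  fixes p :: "'c :: {banach, real_normed_field}"
  assumes "norm p < 1"
  shows "((\<lambda>k. p powi k) has_sum 1 / (1 - p)) {0..}"
proof -
  have "((\<lambda>k. p ^ k) has_sum 1 / (1 - p)) UNIV"
    using assms by (intro norm_summable_imp_has_sum geometric_sums) (simp add: norm_power)
  moreover have bij: "bij_betw int UNIV {0..}"
    by (rule bij_betw_byWitness[where f' = nat]) auto
  ultimately show ?thesis
    by (subst has_sum_reindex_bij_betw[OF bij, symmetric]) simp
qed

lemma summable_on_exp_neg_abs:
  fixes a :: real
  assumes "a > 0"
  shows "(\<lambda>k :: int. exp (- (a * \<bar>real_of_int k\<bar>))) summable_on UNIV"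
proof -
  let ?f = "\<lambda>k :: int. exp (- (a * \<bar>real_of_int k\<bar>))"
  have "(\<lambda>k. exp (-a) powi k) summable_on {0..}"
    using has_sum_geometric_int[of "exp (-a)"] assms by (auto simp: summable_on_def)
  then have pos: "?f summable_on {0..}"
    by (rule summable_on_cong[THEN iffD1, rotated]) (auto simp: exp_power_int mult.commute)
  have "bij_betw uminus {..0} {0 :: int..}"
    by (rule bij_betw_byWitness[where f' = uminus]) auto
  from summable_on_reindex_bij_betw[OF this, of ?f] pos
  have "?f summable_on {..0}" by simp
  \<comment> \<open>The reflected half also contains 0, which is dropped so that the two halves are
    disjoint.\<close>
  then have "?f summable_on {..<0}"
    by (rule summable_on_subset_banach) auto
  then have "?f summable_on ({..<0} \<union> {0..})"
    by (rule summable_on_Un_disjoint[OF _ pos]) auto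
  also have "{..<0} \<union> {0..} = (UNIV :: int set)" by auto
  finally show ?thesis .
qed

text \<open>Expanding the product of the \<open>1 + h x\<close> over a finite set yields
  \<open>prod h\<close> summed over all its subsets, and \<open>1 + h x \<le> exp (h x)\<close>
  bounds this by the exponential of the total sum of \<open>h\<close>.\<close>

lemma summable_on_prod_finite_sets:
  fixes h :: "'a \<Rightarrow> real"
  assumes nonneg: "\<And>x. h x \<ge> 0" and h: "h summable_on UNIV"
  shows "prod h summable_on {s. finite s}"
proof (rule nonneg_bdd_above_summable_on)
  show "bdd_above (sum (prod h) ` {F. F \<subseteq> {s. finite s} \<and> finite F})"
  proof (rule bdd_aboveI2)
    fix F :: "'a set set" assume "F \<in> {F. F \<subseteq> {s. finite s} \<and> finite F}"
    then have F: "finite (\<Union>F)" "F \<subseteq> Pow (\<Union>F)" by auto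
    have "sum (prod h) F \<le> sum (prod h) (Pow (\<Union>F))"
      using F by (intro sum_mono2 prod_nonneg) (auto simp: nonneg prod_nonneg)
    also have "\<dots> = (\<Prod>x\<in>\<Union>F. 1 + h x)"
      using prod_add[OF F(1), of h "\<lambda>_. 1"] by (simp add: add.commute)
    also have "\<dots> \<le> exp (sum h (\<Union>F))"
      using nonneg by (intro prod_le_exp_sum) auto
    also have "\<dots> \<le> exp (infsum h UNIV)"
      using F h nonneg by (simp add: finite_sum_le_infsum)
    finally show "sum (prod h) F \<le> exp (infsum h UNIV)" .
  qed
qed (simp add: nonneg prod_nonneg)

section \<open>Monomials with integer exponents\<close>

lemma monomial_add:
  assumes "\<And>j. z $ j \<noteq> 0"
  shows "monomial z (b + b') = monomial z b * monomial z b'"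
  using assms by (simp add: monomial_def power_int_add prod.distrib)

lemma power_int_sum:
  fixes x :: "'a :: field"
  assumes "x \<noteq> 0"
  shows "x powi (\<Sum>i\<in>I. f i) = (\<Prod>i\<in>I. x powi f i)"
  by (induction I rule: infinite_finite_induct) (simp_all add: power_int_add assms)

lemma prod_power_int:
  fixes f :: "'b \<Rightarrow> 'a :: field"
  shows "(\<Prod>i\<in>I. f i) powi k = (\<Prod>i\<in>I. f i powi k)"
  by (induction I rule: infinite_finite_induct) (simp_all add: power_int_mult_distrib)

text \<open>Exchanging the two products separates the coordinates of \<open>v\<close>, so that sums
  over vectors become products of one-variable geometric series.\<close>

lemma monomial_mult_vec:
  assumes "\<And>j. z $ j \<noteq> 0"
  shows "monomial z (A *v v) = (\<Prod>i\<in>UNIV. monomial z (column i A) powi (v $ i))"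
proof -
  have "monomial z (A *v v) = (\<Prod>j\<in>UNIV. \<Prod>i\<in>UNIV. z $ j powi (A $ j $ i * v $ i))"
    by (simp add: monomial_def matrix_vector_mult_def power_int_sum assms)
  also have "\<dots> = (\<Prod>i\<in>UNIV. \<Prod>j\<in>UNIV. z $ j powi (A $ j $ i * v $ i))"
    by (rule prod.swap)
  finally show ?thesis
    by (simp add: monomial_def column_def prod_power_int power_int_mult)
qed

section \<open>Simplices and dominated points\<close>

text \<open>
  The relations \<open>lt i\<close> are \<open>x $ i < y $ i\<close> for a generic lattice and \<open>\<phi> x $ i < \<phi> y $ i\<close> otherwise.
  The weights will be \<open>c i = - ln \<bar>z\<^sup>a\<bar>\<close> with \<open>a\<close> the \<open>i\<close>-th column.
\<close>
locale ordered_lattice =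
  fixes L :: "(int ^ 'n) set"
    and lt :: "'n \<Rightarrow> int ^ 'n \<Rightarrow> int ^ 'n \<Rightarrow> bool"
    and c :: "'n \<Rightarrow> real"
  assumes zero_mem: "0 \<in> L"
    and add_mem: "x \<in> L \<Longrightarrow> y \<in> L \<Longrightarrow> x + y \<in> L"
    and uminus_mem: "x \<in> L \<Longrightarrow> - x \<in> L"
    and lt_irrefl: "\<not> lt i x x"
    and lt_trans: "lt i x y \<Longrightarrow> lt i y w \<Longrightarrow> lt i x w"
    and lt_translate: "x \<in> L \<Longrightarrow> y \<in> L \<Longrightarrow> v \<in> L \<Longrightarrow> lt i x y \<Longrightarrow> lt i (x + v) (y + v)"
    and lt_imp_le: "x \<in> L \<Longrightarrow> y \<in> L \<Longrightarrow> lt i x y \<Longrightarrow> x $ i \<le> y $ i"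
    and weight_pos: "c i > 0"
    and weight_orthogonal: "x \<in> L \<Longrightarrow> (\<Sum>i\<in>UNIV. c i * real_of_int (x $ i)) = 0"
begin

text \<open>For finite nonempty \<open>s\<close> these are the lattice points strictly below the
  maximum of \<open>s\<close>, that is, the obstructions to being a simplex. Phrasing this through
  \<open>lt\<close> treats the generic and the perturbed case alike.\<close>

definition dominated :: "(int ^ 'n) set \<Rightarrow> (int ^ 'n) set" where
  "dominated s = {x \<in> L. \<forall>i. \<exists>y\<in>s. lt i x y}"

definition nbhd :: "(int ^ 'n) set set" where
  "nbhd = {s. finite s \<and> s \<noteq> {} \<and> s \<subseteq> L \<and> dominated s = {}}"

abbreviation translate :: "int ^ 'n \<Rightarrow> (int ^ 'n) set \<Rightarrow> (int ^ 'n) set" where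
  "translate v s \<equiv> (\<lambda>x. x + v) ` s"

text \<open>For the intended \<open>c\<close>, \<open>exp (- weight u)\<close> is the norm of
  \<open>monomial z (A *v u)\<close>.\<close>

definition weight :: "int ^ 'n \<Rightarrow> real" where
  "weight u = (\<Sum>i\<in>UNIV. c i * real_of_int (u $ i))"

lemma diff_mem: "x \<in> L \<Longrightarrow> y \<in> L \<Longrightarrow> x - y \<in> L"
  using add_mem[of x "- y"] uminus_mem by simp

lemma weight_add: "weight (u + v) = weight u + weight v"
  by (simp add: weight_def algebra_simps sum.distrib)

lemma weight_lattice: "x \<in> L \<Longrightarrow> weight x = 0"
  by (simp add: weight_def weight_orthogonal)

lemma translate_inverse: "translate (- v) (translate v s) = s"
  by (simp add: image_image)

lemma translate_add: "translate v (translate u s) = translate (u + v) s"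
  by (simp add: image_image add.assoc)

lemma dominated_empty: "dominated {} = {}"
  by (simp add: dominated_def)

text \<open>In each coordinate \<open>v\<close> is below some point of \<open>s\<close>, which
  differs from \<open>v\<close> by irreflexivity. By transitivity that point can replace
  \<open>v\<close> wherever \<open>v\<close> serves as an upper witness.\<close>

lemma dominated_toggle:
  assumes v: "v \<in> dominated s"
  shows "dominated (toggle v s) = dominated s"
proof -
  have v': "\<exists>y\<in>s - {v}. lt i v y" for i
    using v lt_irrefl unfolding dominated_def by fastforce
  have less: "\<exists>y\<in>s - {v}. lt i x y" if "\<exists>y\<in>insert v s. lt i x y" for i x
    using that v'[of i] lt_trans[of i x] by blast
  \<comment> \<open>Both \<open>s\<close> and its toggle lie between \<open>s - {v}\<close> and
    \<open>insert v s\<close>, so all sets in this range are treated at once.\<close>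
  have eq: "(\<exists>y\<in>s'. lt i x y) \<longleftrightarrow> (\<exists>y\<in>s - {v}. lt i x y)"
    if "s - {v} \<subseteq> s'" "s' \<subseteq> insert v s" for s' i x
    using that less[of i x] by blast
  have "dominated s' = {x \<in> L. \<forall>i. \<exists>y\<in>s - {v}. lt i x y}"
    if "s - {v} \<subseteq> s'" "s' \<subseteq> insert v s" for s'
    using eq[OF that] by (simp add: dominated_def)
  from this[of s] this[of "toggle v s"] show ?thesis
    by (simp add: toggle_def subset_insertI2 split: if_splits)
qed

text \<open>A lattice point dominated by the translate shifts back by \<open>v\<close> to one
  dominated by \<open>s\<close>.\<close>

lemma translate_mem_nbhd:
  assumes s: "s \<in> nbhd" and v: "v \<in> L"
  shows "translate v s \<in> nbhd"
proof -
  have "dominated (translate v s) = {}"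
  proof (rule ccontr)
    assume "dominated (translate v s) \<noteq> {}"
    then obtain x where x: "x \<in> L" "\<And>i. \<exists>y\<in>s. lt i x (y + v)"
      by (auto simp: dominated_def)
    have "\<exists>y\<in>s. lt i (x - v) y" for i
    proof -
      obtain y where y: "y \<in> s" "lt i x (y + v)" using x by blast
      moreover have "y + v \<in> L" using s y v add_mem by (auto simp: nbhd_def)
      ultimately show ?thesis
        using lt_translate[OF x(1) _ uminus_mem[OF v], of "y + v" i] by force
    qed
    then have "x - v \<in> dominated s"
      using diff_mem x v by (simp add: dominated_def)
    with s show False by (simp add: nbhd_def)
  qed
  then show ?thesis using s v add_mem by (auto simp: nbhd_def)
qed

section \<open>Weight bounds and finiteness\<close>

text \<open>Since \<open>x\<close> has weight 0, a negative coordinate must be balanced by the other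
  coordinates, whose weighted sum \<open>?r x\<close> is at most \<open>?r u\<close>. A nonnegative
  coordinate is bounded by that of \<open>u\<close> directly.\<close>

lemma weight_abs_le:
  assumes x: "x \<in> L" and le: "\<And>j. x $ j \<le> u $ j" and nonneg: "\<And>j. 0 \<le> u $ j"
  shows "c i * \<bar>real_of_int (x $ i)\<bar> \<le> weight u"
proof -
  let ?r = "\<lambda>v :: int ^ 'n. \<Sum>j\<in>UNIV - {i}. c j * real_of_int (v $ j)"
  have split: "weight v = c i * real_of_int (v $ i) + ?r v" for v
    unfolding weight_def by (subst sum.remove[of _ i]) auto
  have "?r x \<le> ?r u"
    using weight_pos le by (intro sum_mono mult_left_mono) (auto simp: less_imp_le)
  moreover have "0 \<le> ?r u"
    using weight_pos nonneg by (intro sum_nonneg mult_nonneg_nonneg) (auto simp: less_imp_le)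
  moreover have "c i * real_of_int (x $ i) \<le> c i * real_of_int (u $ i)" "0 \<le> c i * real_of_int (u $ i)"
    using weight_pos[of i] le nonneg by auto
  ultimately show ?thesis
    using split[of x] split[of u] weight_lattice[OF x] by (auto simp: abs_if)
qed

lemma finite_lattice_below:
  assumes nonneg: "\<And>j. 0 \<le> u $ j"
  shows "finite {x \<in> L. \<forall>i. x $ i \<le> u $ i}"
proof (rule finite_subset)
  have "x $ i \<in> {-\<lceil>weight u / c i\<rceil>..\<lceil>weight u / c i\<rceil>}" if "x \<in> L" "\<forall>j. x $ j \<le> u $ j" for x i
  proof -
    have "\<bar>real_of_int (x $ i)\<bar> \<le> weight u / c i"
      using weight_abs_le[OF that(1) _ nonneg, of i] that(2) weight_pos[of i] by (simp add: field_simps)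
    then show ?thesis by (simp add: abs_le_iff) linarith
  qed
  then show "{x \<in> L. \<forall>i. x $ i \<le> u $ i} \<subseteq> {x. \<forall>i. x $ i \<in> {-\<lceil>weight u / c i\<rceil>..\<lceil>weight u / c i\<rceil>}}"
    by auto
qed (rule finite_vec_box, simp)

section \<open>Euler characteristic of the simplices below a point\<close>

text \<open>
  Toggling a dominated point keeps the set of dominated points, so the sets with a dominated point
  cancel in pairs, and the alternating sum over the complex is that over a full simplex.
\<close>
lemma euler_characteristic_below:
  assumes nonneg: "\<And>j. 0 \<le> u $ j"
  shows "(\<Sum>s\<in>{s \<in> nbhd. \<forall>x\<in>s. \<forall>i. x $ i \<le> u $ i}. (-1) ^ simplex_dim s) = (1 :: 'c :: {idom, ring_char_0})"
proof -
  define V where "V = {x \<in> L. \<forall>i. x $ i \<le> u $ i}"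
  have V: "finite V" "0 \<in> V"
    using finite_lattice_below nonneg zero_mem by (auto simp: V_def)
  have fin: "finite s" if "s \<in> Pow V" for s
    using that V finite_subset by auto
  define K where "K = {s \<in> nbhd. \<forall>x\<in>s. \<forall>i. x $ i \<le> u $ i}"
  define B where "B = {s \<in> Pow V. dominated s \<noteq> {}}"
  have K: "K = {s \<in> Pow V. s \<noteq> {} \<and> dominated s = {}}"
    using fin by (auto simp: K_def nbhd_def V_def)
  \<comment> \<open>This keeps the pairing of non-simplices inside \<open>Pow V\<close>.\<close>
  have dominated_le: "dominated s \<subseteq> V" if "s \<in> Pow V" for s
  proof
    fix x assume x: "x \<in> dominated s"
    have "x $ i \<le> u $ i" for i
    proof -
      obtain y where y: "y \<in> s" "lt i x y" using x by (auto simp: dominated_def)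
      with that have "y \<in> L" "y $ i \<le> u $ i" by (auto simp: V_def)
      moreover have "x $ i \<le> y $ i"
        using x y \<open>y \<in> L\<close> by (intro lt_imp_le) (auto simp: dominated_def)
      ultimately show ?thesis by simp
    qed
    with x show "x \<in> V" by (simp add: V_def dominated_def)
  qed
  \<comment> \<open>The fixed point 0 is toggled; it lies in \<open>V\<close> because
    \<open>u\<close> is nonnegative.\<close>
  have all: "(\<Sum>s\<in>Pow V. (-1 :: 'c) ^ card s) = 0"
    by (rule sum_sign_toggle_eq_0[where v = "\<lambda>_. 0"]) (use V fin in \<open>auto simp: toggle_def\<close>)
  have bad: "(\<Sum>s\<in>B. (-1 :: 'c) ^ card s) = 0"
  proof (rule sum_sign_toggle_eq_0[where v = "\<lambda>s. SOME x. x \<in> dominated s"])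
    fix s assume s: "s \<in> B"
    then have some: "(SOME x. x \<in> dominated s) \<in> dominated s"
      by (auto simp: B_def some_in_eq)
    show "finite s" using s fin by (simp add: B_def)
    show "toggle (SOME x. x \<in> dominated s) s \<in> B"
      using s some dominated_le[of s] by (auto simp: B_def dominated_toggle) (auto simp: toggle_def split: if_splits)
    show "(SOME x. x \<in> dominated (toggle (SOME x. x \<in> dominated s) s)) = (SOME x. x \<in> dominated s)"
      using some by (simp add: dominated_toggle)
  qed
  \<comment> \<open>The empty set is undominated but not a simplex. Its contribution 1 forces the
    signs \<open>(-1) ^ card s\<close> over \<open>K\<close> to sum to -1, and passing from
    cardinality to dimension turns this into 1.\<close>
  have "Pow V = insert {} (B \<union> K)" "{} \<notin> B \<union> K" "B \<inter> K = {}"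
    by (auto simp: B_def K dominated_empty)
  moreover have "finite B" "finite K"
    using V by (auto simp: B_def K)
  ultimately have "(\<Sum>s\<in>Pow V. (-1 :: 'c) ^ card s) = 1 + ((\<Sum>s\<in>B. (-1) ^ card s) + (\<Sum>s\<in>K. (-1) ^ card s))"
    by (simp add: sum.union_disjoint)
  then have "(\<Sum>s\<in>K. (-1 :: 'c) ^ card s) = -1"
    unfolding all bad by (simp add: eq_neg_iff_add_eq_0 add.commute)
  moreover have "(-1 :: 'c) ^ simplex_dim s = - ((-1) ^ card s)" if "s \<in> K" for s
    using that fin[of s] by (cases "card s") (auto simp: K simplex_dim_def)
  ultimately show ?thesis
    by (simp add: K_def[symmetric] sum_negf)
qed

section \<open>Simplices modulo translation\<close>

text \<open>The maximum moves with the set and so records the shift.\<close>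

lemma translate_eq_imp:
  assumes "finite s" "s \<noteq> {}" "translate v s = translate w s"
  shows "v = w"
  by (metis add_left_cancel assms coord_max_translate)

text \<open>The two sets are lattice translates of each other, and a translation class has only one
  representative.\<close>

lemma representatives_eq:
  assumes rep: "representatives_mod L nbhd T" and T: "t \<in> T" "t' \<in> T"
    and eq: "translate v t = translate w t'" and mem: "v \<in> L" "w \<in> L"
  shows "t = t'"
proof -
  have t: "t \<in> nbhd" using rep T by (auto simp: representatives_mod_def)
  then have ex1: "\<exists>!r. r \<in> T \<and> (\<exists>v\<in>L. r = translate v t)"
    using rep by (auto simp: representatives_mod_def)
  have "t' = translate (v - w) t"
  proof -
    have "t' = translate (- w) (translate v t)"
      using translate_inverse[of w t'] eq by simp
    then show ?thesis by (simp only: translate_add diff_conv_add_uminus)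
  qed
  moreover have "t = translate 0 t" by simp
  ultimately show ?thesis
    using ex1 T zero_mem diff_mem[OF mem] by blast
qed

text \<open>The translate of \<open>t\<close> has maximum \<open>u - \<xi>\<close>, which is
  \<open>\<le> u\<close> exactly when \<open>\<xi>\<close> is nonnegative. Conversely
  \<open>s\<close> determines its representative \<open>t\<close>, the shift, and hence
  \<open>\<xi>\<close>.\<close>

lemma fiber_bij:
  assumes rep: "representatives_mod L nbhd T"
  shows "bij_betw (\<lambda>(t, \<xi>). translate (u - (coord_max t + \<xi>)) t)
    {(t, \<xi>). t \<in> T \<and> (\<forall>i. 0 \<le> \<xi> $ i) \<and> u - (coord_max t + \<xi>) \<in> L}
    {s \<in> nbhd. \<forall>x\<in>s. \<forall>i. x $ i \<le> u $ i}"
proof -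
  have T: "t \<in> nbhd" "finite t" "t \<noteq> {}" if "t \<in> T" for t
    using rep that by (auto simp: representatives_mod_def nbhd_def)
  show ?thesis
    unfolding bij_betw_def
  proof (intro conjI inj_onI equalityI subsetI)
    fix p q
    assume "p \<in> {(t, \<xi>). t \<in> T \<and> (\<forall>i. 0 \<le> \<xi> $ i) \<and> u - (coord_max t + \<xi>) \<in> L}"
      and "q \<in> {(t, \<xi>). t \<in> T \<and> (\<forall>i. 0 \<le> \<xi> $ i) \<and> u - (coord_max t + \<xi>) \<in> L}"
      and eq: "(\<lambda>(t, \<xi>). translate (u - (coord_max t + \<xi>)) t) p = (\<lambda>(t, \<xi>). translate (u - (coord_max t + \<xi>)) t) q"
    then obtain t \<xi> t' \<xi>' where pq: "p = (t, \<xi>)" "q = (t', \<xi>')" "t \<in> T" "t' \<in> T"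
      "u - (coord_max t + \<xi>) \<in> L" "u - (coord_max t' + \<xi>') \<in> L" by auto
    have eq': "translate (u - (coord_max t + \<xi>)) t = translate (u - (coord_max t' + \<xi>')) t'"
      using eq pq by simp
    have "t = t'"
      by (rule representatives_eq[OF rep pq(3,4) eq' pq(5,6)])
    moreover have "u - (coord_max t + \<xi>) = u - (coord_max t + \<xi>')"
      using eq' by (intro translate_eq_imp[OF T(2,3)[OF pq(3)]]) (simp only: \<open>t = t'\<close>)
    ultimately show "p = q" using pq by simp
  next
    fix s
    assume "s \<in> (\<lambda>(t, \<xi>). translate (u - (coord_max t + \<xi>)) t) `
      {(t, \<xi>). t \<in> T \<and> (\<forall>i. 0 \<le> \<xi> $ i) \<and> u - (coord_max t + \<xi>) \<in> L}"
    then obtain t \<xi> where t: "t \<in> T" "\<And>i. 0 \<le> \<xi> $ i" "u - (coord_max t + \<xi>) \<in> L"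
      and s: "s = translate (u - (coord_max t + \<xi>)) t" by auto
    have "x $ i + (u - (coord_max t + \<xi>)) $ i \<le> u $ i" if "x \<in> t" for x i
      using coord_max_ge[of t x i] T[OF t(1)] that t(2)[of i] by simp
    then show "s \<in> {s \<in> nbhd. \<forall>x\<in>s. \<forall>i. x $ i \<le> u $ i}"
      using translate_mem_nbhd[OF T(1)[OF t(1)] t(3)] by (auto simp: s)
  next
    fix s assume s: "s \<in> {s \<in> nbhd. \<forall>x\<in>s. \<forall>i. x $ i \<le> u $ i}"
    then have "\<exists>!t. t \<in> T \<and> (\<exists>v\<in>L. t = translate v s)"
      using rep by (simp add: representatives_mod_def)
    then obtain t v where t: "t \<in> T" "v \<in> L" "t = translate v s"
      by (elim ex1E conjE bexE)
    have sf: "finite s" "s \<noteq> {}" using s by (auto simp: nbhd_def)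
    \<comment> \<open>The slack between \<open>u\<close> and the maximum of \<open>s\<close>; with
      it the prescribed shift becomes \<open>- v\<close>, which carries \<open>t\<close> back to
      \<open>s\<close>.\<close>
    define \<xi> where "\<xi> = u - coord_max s"
    have "u - (coord_max t + \<xi>) = - v"
      using coord_max_translate[OF sf, of v] by (simp add: \<xi>_def t)
    moreover have "0 \<le> \<xi> $ i" for i
      using s sf by (simp add: \<xi>_def coord_max_le_iff)
    ultimately have "s = (\<lambda>(t, \<xi>). translate (u - (coord_max t + \<xi>)) t) (t, \<xi>)"
      "(t, \<xi>) \<in> {(t, \<xi>). t \<in> T \<and> (\<forall>i. 0 \<le> \<xi> $ i) \<and> u - (coord_max t + \<xi>) \<in> L}"
      using t uminus_mem[OF t(2)] translate_inverse[of v s] by auto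
    then show "s \<in> (\<lambda>(t, \<xi>). translate (u - (coord_max t + \<xi>)) t) `
      {(t, \<xi>). t \<in> T \<and> (\<forall>i. 0 \<le> \<xi> $ i) \<and> u - (coord_max t + \<xi>) \<in> L}"
      by (rule image_eqI)
  qed
qed

text \<open>Translation preserves dimension, so the signs transfer along the bijection to the Euler
  characteristic.\<close>

lemma fiber_sum:
  assumes rep: "representatives_mod L nbhd T" and nonneg: "\<And>j. 0 \<le> u $ j"
  shows "finite {(t, \<xi>). t \<in> T \<and> (\<forall>i. 0 \<le> \<xi> $ i) \<and> u - (coord_max t + \<xi>) \<in> L}" (is "finite ?F")
    and "(\<Sum>(t, \<xi>)\<in>{(t, \<xi>). t \<in> T \<and> (\<forall>i. 0 \<le> \<xi> $ i) \<and> u - (coord_max t + \<xi>) \<in> L}. (-1) ^ simplex_dim t)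
      = (1 :: 'c :: {idom, ring_char_0})"
proof -
  have "{s \<in> nbhd. \<forall>x\<in>s. \<forall>i. x $ i \<le> u $ i} \<subseteq> Pow {x \<in> L. \<forall>i. x $ i \<le> u $ i}"
    by (auto simp: nbhd_def)
  then have "finite {s \<in> nbhd. \<forall>x\<in>s. \<forall>i. x $ i \<le> u $ i}"
    by (rule finite_subset) (simp add: finite_lattice_below nonneg)
  then show "finite ?F"
    using bij_betw_finite[OF fiber_bij[OF rep]] by blast
  have "(\<Sum>(t, \<xi>)\<in>?F. (-1) ^ simplex_dim t)
      = (\<Sum>p\<in>?F. (-1) ^ simplex_dim ((\<lambda>(t, \<xi>). translate (u - (coord_max t + \<xi>)) t) p) :: 'c)"
    by (intro sum.cong refl) (auto simp: simplex_dim_translate)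
  also have "\<dots> = (\<Sum>s\<in>{s \<in> nbhd. \<forall>x\<in>s. \<forall>i. x $ i \<le> u $ i}. (-1) ^ simplex_dim s)"
    by (rule sum.reindex_bij_betw[OF fiber_bij[OF rep]])
  finally show "(\<Sum>(t, \<xi>)\<in>?F. (-1) ^ simplex_dim t) = (1 :: 'c)"
    using euler_characteristic_below[where 'c = 'c] nonneg by simp
qed

section \<open>Convergence of the sum over simplices\<close>

text \<open>No vertex is dominated, so each has a coordinate in which no vertex exceeds it. Totality
  prevents two vertices from sharing such a coordinate.\<close>

lemma card_nbhd_le:
  assumes s: "s \<in> nbhd" and total: "\<And>i x y. x \<in> s \<Longrightarrow> y \<in> s \<Longrightarrow> x \<noteq> y \<Longrightarrow> lt i x y \<or> lt i y x"
  shows "card s \<le> CARD('n)"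
proof -
  have "\<exists>i. \<forall>y\<in>s. \<not> lt i x y" if "x \<in> s" for x
  proof -
    have "x \<in> L" "x \<notin> dominated s" using s that by (auto simp: nbhd_def)
    then show ?thesis by (simp add: dominated_def)
  qed
  then obtain m where m: "\<And>x y. x \<in> s \<Longrightarrow> y \<in> s \<Longrightarrow> \<not> lt (m x) x y"
    by metis
  have "inj_on m s"
    using m total by (metis inj_onI)
  then show ?thesis by (rule card_inj_on_le) auto
qed

text \<open>
  When \<open>0 \<in> s\<close>, the maximum is nonnegative, and its weight bounds the weighted \<open>L\<^sup>1\<close> norm of each of
  the at most \<open>n\<close> vertices up to a factor \<open>n\<close>.  This gives a comparison with the sum over all finite
  sets \<open>s\<close> of \<open>prod h s\<close>, that is, with the convergent product of the \<open>1 + h x\<close>.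
\<close>
lemma summable_exp_weight_pointed:
  assumes total: "\<And>s i x y. s \<in> nbhd \<Longrightarrow> x \<in> s \<Longrightarrow> y \<in> s \<Longrightarrow> x \<noteq> y \<Longrightarrow> lt i x y \<or> lt i y x"
  shows "(\<lambda>s. exp (- weight (coord_max s))) summable_on {s \<in> nbhd. 0 \<in> s}"
proof -
  define n where "n = real CARD('n)"
  have n: "n > 0" by (simp add: n_def)
  \<comment> \<open>One factor \<open>n\<close> in \<open>n\<^sup>2\<close> accounts for the
    coordinates of a vertex, the other for the number of vertices.\<close>
  define h :: "int ^ 'n \<Rightarrow> real" where
    "h x = (\<Prod>i\<in>UNIV. exp (- (c i / n\<^sup>2 * \<bar>real_of_int (x $ i)\<bar>)))" for x
  have "(\<lambda>k. norm (exp (- (c i / n\<^sup>2 * \<bar>real_of_int k\<bar>)))) summable_on UNIV" for i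
    using summable_on_exp_neg_abs[of "c i / n\<^sup>2"] weight_pos[of i] n by simp
  from abs_summable_on_prod_vec[where B = "\<lambda>_. UNIV" and f = "\<lambda>i k. exp (- (c i / n\<^sup>2 * \<bar>real_of_int k\<bar>))", OF this]
  have "h summable_on UNIV"
    by (simp add: h_def[abs_def] abs_prod)
  then have "prod h summable_on {s. finite s}"
    by (intro summable_on_prod_finite_sets) (simp_all add: h_def prod_nonneg)
  then have sm: "prod h summable_on {s \<in> nbhd. 0 \<in> s}"
    by (rule summable_on_subset_banach) (auto simp: nbhd_def)
  show ?thesis
  proof (rule summable_on_comparison_test[OF sm])
    fix s assume "s \<in> {s \<in> nbhd. 0 \<in> s}"
    then have s: "s \<in> nbhd" "0 \<in> s" "finite s" "s \<subseteq> L" by (auto simp: nbhd_def)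
    let ?w = "weight (coord_max s)"
    have nonneg: "0 \<le> coord_max s $ j" for j
      using coord_max_ge[OF s(3,2), of j] by simp
    then have w: "?w \<ge> 0"
      unfolding weight_def using weight_pos by (intro sum_nonneg mult_nonneg_nonneg) (auto simp: less_imp_le)
    have "(\<Sum>x\<in>s. \<Sum>i\<in>UNIV. c i * \<bar>real_of_int (x $ i)\<bar>) \<le> (\<Sum>x\<in>s. \<Sum>i\<in>(UNIV :: 'n set). ?w)"
      using s nonneg by (intro sum_mono weight_abs_le coord_max_ge) auto
    also have "\<dots> = real (card s) * (n * ?w)" by (simp add: n_def)
    also have "\<dots> \<le> n * (n * ?w)"
      using card_nbhd_le[OF s(1) total[OF s(1)]] n w by (intro mult_right_mono) (auto simp: n_def)
    finally have "(\<Sum>x\<in>s. \<Sum>i\<in>UNIV. c i * \<bar>real_of_int (x $ i)\<bar>) / n\<^sup>2 \<le> ?w"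
      using n by (simp add: field_simps power2_eq_square)
    moreover have "prod h s = exp (- ((\<Sum>x\<in>s. \<Sum>i\<in>UNIV. c i * \<bar>real_of_int (x $ i)\<bar>) / n\<^sup>2))"
      using s by (simp add: h_def exp_sum[symmetric] sum_negf sum_divide_distrib)
    ultimately show "exp (- ?w) \<le> prod h s" by simp
  qed simp
qed

text \<open>Each representative is moved so that a chosen vertex lands at 0. This is injective on
  representatives and, lattice vectors having weight 0, preserves the weight of the maximum.\<close>

lemma summable_exp_weight:
  assumes rep: "representatives_mod L nbhd T"
    and total: "\<And>s i x y. s \<in> nbhd \<Longrightarrow> x \<in> s \<Longrightarrow> y \<in> s \<Longrightarrow> x \<noteq> y \<Longrightarrow> lt i x y \<or> lt i y x"
  shows "(\<lambda>s. exp (- weight (coord_max s))) summable_on T"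
proof -
  have T: "t \<in> nbhd" "finite t" "t \<noteq> {}" "t \<subseteq> L" if "t \<in> T" for t
    using rep that by (auto simp: representatives_mod_def nbhd_def)
  define \<sigma> where "\<sigma> t = translate (- (SOME x. x \<in> t)) t" for t
  have vertex: "(SOME x. x \<in> t) \<in> t" if "t \<in> T" for t
    using T[OF that] by (simp add: some_in_eq)
  have mem: "- (SOME x. x \<in> t) \<in> L" if "t \<in> T" for t
    using vertex[OF that] T[OF that] uminus_mem by blast
  have "inj_on \<sigma> T"
  proof (rule inj_onI)
    fix t t' assume t: "t \<in> T" "t' \<in> T" "\<sigma> t = \<sigma> t'"
    show "t = t'"
      by (rule representatives_eq[OF rep t(1,2) t(3)[unfolded \<sigma>_def] mem[OF t(1)] mem[OF t(2)]])
  qed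
  moreover have "\<sigma> t \<in> {s \<in> nbhd. 0 \<in> s}" if "t \<in> T" for t
    using vertex[OF that] translate_mem_nbhd[OF T(1)[OF that] mem[OF that]]
    by (auto simp: \<sigma>_def image_iff intro!: bexI[of _ "SOME x. x \<in> t"])
  then have "(\<lambda>s. exp (- weight (coord_max s))) summable_on \<sigma> ` T"
    by (intro summable_on_subset_banach[OF summable_exp_weight_pointed[OF total]]) auto
  ultimately have "(\<lambda>t. exp (- weight (coord_max (\<sigma> t)))) summable_on T"
    by (simp add: summable_on_reindex o_def)
  moreover have "weight (coord_max (\<sigma> t)) = weight (coord_max t)" if "t \<in> T" for t
    unfolding \<sigma>_def using T[OF that] mem[OF that] by (subst coord_max_translate) (simp_all add: weight_add weight_lattice del: add_uminus_conv_diff)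
  ultimately show ?thesis
    by (simp cong: summable_on_cong)
qed

end

section \<open>Comparison of the generating functions\<close>

lemma norm_monomial_mult_vec:
  assumes "z \<in> convergence_domain A"
  shows "norm (monomial z (A *v v)) = exp (\<Sum>i\<in>UNIV. ln (norm (monomial z (column i A))) * real_of_int (v $ i))"
proof -
  have nz: "z $ j \<noteq> 0" for j using assms by (simp add: convergence_domain_def)
  then have "norm (monomial z (column i A)) > 0" for i by (simp add: monomial_def)
  then have "norm (monomial z (column i A)) powi k = exp (ln (norm (monomial z (column i A))) * real_of_int k)" for i k
    using exp_power_int[of "ln (norm (monomial z (column i A)))" k] by (simp add: mult.commute)
  then show ?thesis
    by (simp add: monomial_mult_vec nz prod_norm[symmetric] norm_power_int exp_sum)
qed

text \<open>The weights are positive because the column monomials have norm in (0, 1). They are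
  orthogonal to the lattice because \<open>A *v x = 0\<close> makes the monomial equal to 1, whose
  norm has logarithm 0.\<close>

lemma ordered_lattice_lattice_of:
  assumes z: "z \<in> convergence_domain A"
    and "\<And>i x. \<not> lt i x x" "\<And>i x y w. lt i x y \<Longrightarrow> lt i y w \<Longrightarrow> lt i x w"
    and "\<And>i x y v. x \<in> lattice_of A \<Longrightarrow> y \<in> lattice_of A \<Longrightarrow> v \<in> lattice_of A \<Longrightarrow> lt i x y
      \<Longrightarrow> lt i (x + v) (y + v)"
    and "\<And>i x y. x \<in> lattice_of A \<Longrightarrow> y \<in> lattice_of A \<Longrightarrow> lt i x y \<Longrightarrow> x $ i \<le> y $ i"
  shows "ordered_lattice (lattice_of A) lt (\<lambda>i. - ln (norm (monomial z (column i A))))"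
proof
  show "0 \<in> lattice_of A" by (simp add: lattice_of_def)
  show "x + y \<in> lattice_of A" if "x \<in> lattice_of A" "y \<in> lattice_of A" for x y
    using that by (simp add: lattice_of_def matrix_vector_right_distrib)
  show "- x \<in> lattice_of A" if "x \<in> lattice_of A" for x
    using that by (simp add: lattice_of_def matrix_vector_mult_def vec_eq_iff sum_negf)
  show "0 < - ln (norm (monomial z (column i A)))" for i
    using z by (simp add: convergence_domain_def monomial_def)
  show "(\<Sum>i\<in>UNIV. - ln (norm (monomial z (column i A))) * real_of_int (x $ i)) = 0"
    if "x \<in> lattice_of A" for x
    using norm_monomial_mult_vec[OF z, of x] that
    by (simp add: lattice_of_def sum_negf) (simp add: monomial_def)
qed (use assms in auto)

text \<open>One absolutely convergent double series is summed in two ways: as a product over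
  \<open>T \<times> N\<close> it gives \<open>complex_gf\<close>, and grouped by exponent it gives
  \<open>semigroup_gf\<close>.\<close>

lemma (in ordered_lattice) generating_function:
  fixes A :: "int ^ 'n ^ 'd"
  assumes L: "L = lattice_of A" and c: "c = (\<lambda>i. - ln (norm (monomial z (column i A))))"
    and z: "z \<in> convergence_domain A"
    and rep: "representatives_mod L nbhd T"
    and total: "\<And>s i x y. s \<in> nbhd \<Longrightarrow> x \<in> s \<Longrightarrow> y \<in> s \<Longrightarrow> x \<noteq> y \<Longrightarrow> lt i x y \<or> lt i y x"
  shows "monomial z summable_on semigroup_of A"
    and "(\<lambda>s. (-1) ^ simplex_dim s * monomial z (A *v coord_max s)) summable_on T"
    and "semigroup_gf A z = complex_gf A T z"
proof -
  define p where "p i = monomial z (column i A)" for i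
  have nz: "z $ j \<noteq> 0" for j using z by (simp add: convergence_domain_def)
  have p: "norm (p i) < 1" for i using z by (simp add: convergence_domain_def p_def)
  define a where "a s = (-1) ^ simplex_dim s * monomial z (A *v coord_max s)" for s
  define N :: "(int ^ 'n) set" where "N = {\<xi>. \<forall>i. 0 \<le> \<xi> $ i}"
  have N: "N = {\<xi>. \<forall>i. \<xi> $ i \<in> {0..}}" by (simp add: N_def)

  have "(\<lambda>k. norm (p i powi k)) summable_on {0..}" for i
    using has_sum_geometric_int[of "norm (p i)"] p by (auto simp: norm_power_int summable_on_def)
  then have p_sum: "(\<lambda>\<xi>. norm (monomial z (A *v \<xi>))) summable_on N"
      and p_inf: "(\<Sum>\<^sub>\<infinity>\<xi>\<in>N. monomial z (A *v \<xi>)) = (\<Prod>i\<in>UNIV. infsum ((powi) (p i)) {0..})"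
    using abs_summable_on_prod_vec[where f = "\<lambda>i k. p i powi k" and B = "\<lambda>_. {0..}"]
      infsum_prod_vec[where f = "\<lambda>i k. p i powi k" and B = "\<lambda>_. {0..}"]
    by (simp_all add: N monomial_mult_vec nz p_def[symmetric])
  have geometric: "(\<Sum>\<^sub>\<infinity>\<xi>\<in>N. monomial z (A *v \<xi>)) = 1 / (\<Prod>i\<in>UNIV. 1 - p i)"
    unfolding p_inf by (simp add: infsumI[OF has_sum_geometric_int[OF p]] prod_dividef)

  have "- weight v = (\<Sum>i\<in>UNIV. ln (norm (monomial z (column i A))) * real_of_int (v $ i))" for v
    unfolding weight_def by (simp add: c sum_negf)
  then have "norm (a s) = exp (- weight (coord_max s))" for s
    by (simp add: a_def norm_mult norm_power norm_monomial_mult_vec[OF z])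
  then have a_sum: "(\<lambda>s. norm (a s)) summable_on T"
    using summable_exp_weight[OF rep total] by simp
  then show "(\<lambda>s. (-1) ^ simplex_dim s * monomial z (A *v coord_max s)) summable_on T"
    unfolding a_def by (rule abs_summable_summable)

  \<comment> \<open>The numerator series times the expanded denominator; absolute convergence
    permits the regrouping below.\<close>
  define F where "F = (\<lambda>(s, \<xi>). a s * monomial z (A *v \<xi>))"
  have "(\<lambda>q. norm (F q)) summable_on T \<times> N"
    unfolding Infinite_Sum.abs_summable_on_Sigma_iff
    using a_sum p_sum by (auto simp: F_def norm_mult abs_mult infsum_cmult_right' intro!: summable_on_cmult_right summable_on_cmult_left)
  then have F: "F summable_on T \<times> N" by (rule abs_summable_summable)
  have F_inf: "infsum F (T \<times> N) = complex_gf A T z"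
  proof -
    have "infsum F (T \<times> N) = (\<Sum>\<^sub>\<infinity>s\<in>T. \<Sum>\<^sub>\<infinity>\<xi>\<in>N. a s * monomial z (A *v \<xi>))"
      using infsum_Sigma_banach[OF F] by (simp add: F_def)
    also have "\<dots> = infsum a T / (\<Prod>i\<in>UNIV. 1 - p i)"
      by (simp add: infsum_cmult_right' geometric infsum_cmult_left' divide_inverse)
    finally show ?thesis by (simp add: complex_gf_def a_def[abs_def] p_def)
  qed

  define fiber where "fiber b = {(s, \<xi>). s \<in> T \<and> \<xi> \<in> N \<and> A *v (coord_max s + \<xi>) = b}" for b
  define H where "H = (\<lambda>(b, s :: (int ^ 'n) set, \<xi> :: int ^ 'n). (-1) ^ simplex_dim s * monomial z b)"
  let ?g = "\<lambda>(s, \<xi>). (A *v (coord_max s + \<xi>), s, \<xi>)"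
  have semigroup: "A *v (coord_max s + \<xi>) \<in> semigroup_of A" if "s \<in> T" "\<xi> \<in> N" for s \<xi>
  proof -
    have s: "finite s" "s \<noteq> {}" "s \<subseteq> L"
      using rep that by (auto simp: representatives_mod_def nbhd_def)
    \<comment> \<open>The maximum may have negative coordinates. Subtracting a vertex makes the
      vector nonnegative without changing its image under \<open>A\<close>.\<close>
    then obtain x where x: "x \<in> s" "A *v x = 0" by (auto simp: L lattice_of_def)
    have "0 \<le> (coord_max s + \<xi> - x) $ i" for i
      using coord_max_ge[OF s(1) x(1), of i] that(2) by (simp add: N_def add_increasing2)
    moreover have "A *v (coord_max s + \<xi>) = A *v (coord_max s + \<xi> - x)"
      by (simp add: matrix_vector_mult_diff_distrib x)
    ultimately show ?thesis by (auto simp: semigroup_of_def)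
  qed
  have bij: "bij_betw ?g (T \<times> N) (Sigma (semigroup_of A) fiber)"
    by (rule bij_betw_byWitness[where f' = snd]) (auto simp: fiber_def semigroup)
  have HF: "H (?g q) = F q" if "q \<in> T \<times> N" for q
    by (auto simp: H_def F_def a_def matrix_vector_right_distrib monomial_add nz split: prod.split)
  have H: "H summable_on Sigma (semigroup_of A) fiber"
    using F summable_on_reindex_bij_betw[OF bij, of H] by (simp add: HF cong: summable_on_cong)
  have H_inf: "infsum H (Sigma (semigroup_of A) fiber) = infsum F (T \<times> N)"
    using infsum_reindex_bij_betw[OF bij, of H] by (simp add: HF cong: infsum_cong)
  have inner: "(\<Sum>\<^sub>\<infinity>q\<in>fiber b. H (b, q)) = monomial z b" if b: "b \<in> semigroup_of A" for b
  proof -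
    obtain u where u: "b = A *v u" "\<And>i. 0 \<le> u $ i" using b by (auto simp: semigroup_of_def)
    \<comment> \<open>Two vectors have the same image under \<open>A\<close> exactly when their
      difference lies in the lattice.\<close>
    have fib: "fiber b = {(t, \<xi>). t \<in> T \<and> (\<forall>i. 0 \<le> \<xi> $ i) \<and> u - (coord_max t + \<xi>) \<in> L}"
      by (auto simp: fiber_def N_def u L lattice_of_def matrix_vector_mult_diff_distrib)
    have "(\<Sum>\<^sub>\<infinity>q\<in>fiber b. H (b, q)) = (\<Sum>(t, \<xi>)\<in>fiber b. (-1) ^ simplex_dim t) * monomial z b"
      using fiber_sum(1)[OF rep u(2)] by (simp add: fib H_def sum_distrib_right case_prod_beta)
    then show ?thesis
      using fiber_sum(2)[OF rep u(2), where 'c = complex] by (simp add: fib)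
  qed
  \<comment> \<open>The monomials are the fiber sums of a summable family, and so inherit its
    summability.\<close>
  show "monomial z summable_on semigroup_of A"
    using summable_on_Sigma_banach[of "\<lambda>b q. H (b, q)" "semigroup_of A" fiber] H inner
    by (simp cong: summable_on_cong)
  have "semigroup_gf A z = infsum H (Sigma (semigroup_of A) fiber)"
    using infsum_Sigma_banach[OF H] inner by (simp add: semigroup_gf_def cong: infsum_cong)
  then show "semigroup_gf A z = complex_gf A T z"
    by (simp add: H_inf F_inf)
qed

section \<open>The generic and the perturbed case\<close>

theorem theorem1p3:
  fixes A :: "int ^ 'n ^ 'd" and l :: "real ^ 'd"
    and \<phi> :: "int ^ 'n \<Rightarrow> real ^ 'n"
    and S Sbar :: "(int ^ 'n) set set"
  assumes "\<And>i. l \<bullet> (\<chi> j. real_of_int (column i A $ j)) < 0"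
    and "\<not> generic_lattice (lattice_of A) \<Longrightarrow> proper_perturbation (lattice_of A) \<phi>"
    and "S = neighborhood_complex (lattice_of A) \<phi>"
    and "representatives_mod (lattice_of A) S Sbar"
  shows "\<forall>z\<in>convergence_domain A.
           (\<lambda>b. monomial z b) summable_on semigroup_of A \<and>
           (\<lambda>s. (-1) ^ simplex_dim s * monomial z (A *v coord_max s)) summable_on Sbar \<and>
           semigroup_gf A z = complex_gf A Sbar z"
proof
  let ?L = "lattice_of A"
  fix z assume z: "z \<in> convergence_domain A"
  show "(\<lambda>b. monomial z b) summable_on semigroup_of A \<and>
    (\<lambda>s. (-1) ^ simplex_dim s * monomial z (A *v coord_max s)) summable_on Sbar \<and>
    semigroup_gf A z = complex_gf A Sbar z"
  proof (cases "generic_lattice ?L")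
    case True
    interpret ordered_lattice ?L "\<lambda>i x y. x $ i < y $ i" "\<lambda>i. - ln (norm (monomial z (column i A)))"
      by (rule ordered_lattice_lattice_of[OF z]) auto
    have dom: "dominated s = {x \<in> ?L. strictly_below x (coord_max s)}" if "finite s" "s \<noteq> {}" for s
      using strictly_below_coord_max_iff[OF that, of _ "\<lambda>x. x"] by (simp add: dominated_def)
    have "nbhd = S"
      unfolding assms(3) neighborhood_complex_def nbhd_def
      by (intro Collect_cong conj_cong refl) (simp add: True dom Ball_def)
    \<comment> \<open>Two vertices with a common coordinate would violate genericity: it provides
      \<open>w\<close> strictly below the maximum of \<open>x - y\<close> and 0, so
      \<open>w + y\<close> is strictly below that of \<open>x\<close> and \<open>y\<close>, hence
      dominated by \<open>s\<close>.\<close>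
    moreover have "x $ i < y $ i \<or> y $ i < x $ i" if s: "s \<in> nbhd" "x \<in> s" "y \<in> s" "x \<noteq> y" for s i x y
    proof (rule ccontr)
      assume "\<not> (x $ i < y $ i \<or> y $ i < x $ i)"
      then have "(x - y) $ i = 0" by simp
      moreover have L: "x \<in> ?L" "y \<in> ?L" using s by (auto simp: nbhd_def)
      ultimately obtain w where w: "w \<in> ?L" "strictly_below w (coord_max {x - y, 0})"
        using True diff_mem[OF L] s(4) unfolding generic_lattice_def
        by (metis right_minus_eq)
      have "\<exists>v\<in>s. (w + y) $ j < v $ j" for j
      proof -
        have "w $ j < max (x $ j - y $ j) 0"
          using w(2) by (simp add: strictly_below_def coord_max_def)
        then have "(w + y) $ j < x $ j \<or> (w + y) $ j < y $ j" by (auto simp: max_def split: if_splits)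
        then show ?thesis using s by blast
      qed
      then have "w + y \<in> dominated s"
        using add_mem[OF w(1) L(2)] by (simp add: dominated_def)
      with s show False by (simp add: nbhd_def)
    qed
    ultimately show ?thesis
      using generating_function[OF refl refl z, of Sbar] assms(4) by blast
  next
    case False
    then have \<phi>: "proper_perturbation ?L \<phi>" using assms(2) by blast
    interpret ordered_lattice ?L "\<lambda>i x y. \<phi> x $ i < \<phi> y $ i" "\<lambda>i. - ln (norm (monomial z (column i A)))"
      by (rule ordered_lattice_lattice_of[OF z]) (use \<phi> in \<open>auto simp: proper_perturbation_def\<close>)
    have dom: "dominated s = {x \<in> ?L. strictly_below (\<phi> x) (coord_max (\<phi> ` s))}" if "finite s" "s \<noteq> {}" for s
      by (simp add: dominated_def strictly_below_coord_max_iff[OF that])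
    have "nbhd = S"
      unfolding assms(3) neighborhood_complex_def nbhd_def
      by (intro Collect_cong conj_cong refl) (simp add: False dom Ball_def)
    moreover have "\<phi> x $ i < \<phi> y $ i \<or> \<phi> y $ i < \<phi> x $ i" if s: "s \<in> nbhd" "x \<in> s" "y \<in> s" "x \<noteq> y" for s i x y
    proof -
      have "x \<in> ?L" "y \<in> ?L" using s by (auto simp: nbhd_def)
      with \<phi> s(4) have "\<phi> x $ i \<noteq> \<phi> y $ i" by (auto simp: proper_perturbation_def)
      then show ?thesis by linarith
    qed
    ultimately show ?thesis
      using generating_function[OF refl refl z, of Sbar] assms(4) by blast
  qed
qed

end
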